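(* Let $0<\alpha\leq 1$, $\lambda\geq 1$ and $\mu\geq 0$ be real numbers, and let $f(z)=z+\sum_{n=2}^{\infty}a_n z^n$ be a function in the class $\mathcal{N}_{\Sigma}^{\mu}(\alpha,\lambda)$. Then $$|a_2|\leq \frac{2\alpha}{\sqrt{(\lambda+\mu)^2+\alpha\left(\mu+2\lambda-\lambda^2\right)}}$$ and $$|a_3|\leq \frac{4\alpha^2}{(\lambda+\mu)^2}+\frac{2\alpha}{2\lambda+\mu}.$$
   Context: Let $\mathcal{U}=\{z\in\mathbb{C}:|z|<1\}$ and let $\mathcal{A}$ be the family of functions $f$ analytic in $\mathcal{U}$ of the form $f(z)=z+\sum_{n=2}^{\infty}a_nz^n$. A function $f\in\mathcal{A}$ is bi-univalent in $\mathcal{U}$ if $f$ is univalent (injective) in $\mathcal{U}$ and its inverse $f^{-1}$, which is defined near $0$, extends to a univalent analytic function $g$ on $\mathcal{U}$; thus $g(w)=w-a_2w^2+(2a_2^2-a_3)w^3-(5a_2^3-5a_2a_3+a_4)w^4+\cdots$. $\Sigma$ denotes the class of bi-univalent functions. For $0<\alpha\le 1$, $\mu\ge 0$ and real $\lambda$, a function $f\in\mathcal{A}$ belongs to $\mathcal{N}_{\Sigma}^{\mu}(\alpha,\lambda)$ if $f\in\Sigma$, $$\left|\arg\left((1-\lambda)\left(\frac{f(z)}{z}\right)^{\mu}+\lambda f'(z)\left(\frac{f(z)}{z}\right)^{\mu-1}\right)\right|<\frac{\alpha\pi}{2}\quad (z\in\mathcal{U})$$ and, with $g$ the extension of $f^{-1}$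 to $\mathcal{U}$, $$\left|\arg\left((1-\lambda)\left(\frac{g(w)}{w}\right)^{\mu}+\lambda g'(w)\left(\frac{g(w)}{w}\right)^{\mu-1}\right)\right|<\frac{\alpha\pi}{2}\quad (w\in\mathcal{U}).$$ Here $f(z)/z$ and $g(w)/w$ are understood as the analytic non-vanishing functions on $\mathcal{U}$ equal to $1$ at the origin, the powers are the analytic branches equal to $1$ at the origin, and the condition on $\arg$ includes that the expression inside is nonzero. *)

theory Defs
  imports "HOL-Complex_Analysis.Complex_Analysis"
begin

abbreviation unit_disc :: "complex set" where
  "unit_disc \<equiv> ball 0 1"

definition taylor_form :: "(complex \<Rightarrow> complex) \<Rightarrow> (nat \<Rightarrow> complex) \<Rightarrow> bool" where
  "taylor_form f a \<longleftrightarrow> (\<forall>z\<in>unit_disc. (\<lambda>n. a (n + 2) * z ^ (n + 2)) sums (f z - z))"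

definition class_A :: "(complex \<Rightarrow> complex) set" where
  "class_A = {f. f holomorphic_on unit_disc \<and> (\<exists>a. taylor_form f a)}"

text \<open>Here \<open>g\<close> is a univalent function on the disc whose germ at the origin is that of the
  inverse of \<open>f\<close>. Only the values of \<open>f\<close> and \<open>g\<close> on the disc are relevant, and there \<open>g\<close> is
  uniquely determined, see \<open>inverse_extension_unique\<close>.\<close>

definition inverse_extension :: "(complex \<Rightarrow> complex) \<Rightarrow> (complex \<Rightarrow> complex) \<Rightarrow> bool" where
  "inverse_extension f g \<longleftrightarrow>
     g holomorphic_on unit_disc \<and> inj_on g unit_disc \<and>
     (\<forall>\<^sub>F w in nhds 0. g w = the_inv_into unit_disc f w)"

definition bi_univalent :: "(complex \<Rightarrow> complex) set" where
  "bi_univalent = {f \<in> class_A. inj_on f unit_disc \<and> (\<exists>g. inverse_extension f g)}"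

definition quot :: "(complex \<Rightarrow> complex) \<Rightarrow> complex \<Rightarrow> complex" where
  "quot f z = (if z = 0 then 1 else f z / z)"

text \<open>\<open>log_branch h\<close> is the analytic logarithm on the disc, vanishing at the origin, of an analytic
  non-vanishing \<open>h\<close> with \<open>h 0 = 1\<close>. It exists and is unique on the disc, see \<open>log_branch_exists\<close>
  and \<open>log_branch_unique\<close>. The principal power \<open>h z powr s\<close> would not do, since \<open>h\<close> may take
  values on the negative real axis.\<close>

definition is_log_branch :: "(complex \<Rightarrow> complex) \<Rightarrow> (complex \<Rightarrow> complex) \<Rightarrow> bool" where
  "is_log_branch h L \<longleftrightarrow>
     L holomorphic_on unit_disc \<and> L 0 = 0 \<and> (\<forall>z\<in>unit_disc. exp (L z) = h z)"

definition log_branch :: "(complex \<Rightarrow> complex) \<Rightarrow> complex \<Rightarrow> complex" where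
  "log_branch h = (SOME L. is_log_branch h L)"

definition branch_power :: "(complex \<Rightarrow> complex) \<Rightarrow> real \<Rightarrow> complex \<Rightarrow> complex" where
  "branch_power h s z = exp (complex_of_real s * log_branch h z)"

definition N_expr :: "real \<Rightarrow> real \<Rightarrow> (complex \<Rightarrow> complex) \<Rightarrow> complex \<Rightarrow> complex" where
  "N_expr \<mu> lam f z =
     (1 - complex_of_real lam) * branch_power (quot f) \<mu> z
     + complex_of_real lam * deriv f z * branch_power (quot f) (\<mu> - 1) z"

text \<open>Non-vanishing is stated separately because \<open>Arg 0 = 0\<close> in the library.\<close>

definition arg_condition :: "real \<Rightarrow> real \<Rightarrow> real \<Rightarrow> (complex \<Rightarrow> complex) \<Rightarrow> bool" where
  "arg_condition \<mu> \<alpha> lam f \<longleftrightarrow>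
     (\<forall>z\<in>unit_disc. N_expr \<mu> lam f z \<noteq> 0 \<and> \<bar>Arg (N_expr \<mu> lam f z)\<bar> < \<alpha> * pi / 2)"

definition class_N :: "real \<Rightarrow> real \<Rightarrow> real \<Rightarrow> (complex \<Rightarrow> complex) set" where
  "class_N \<mu> \<alpha> lam =
     {f \<in> bi_univalent. arg_condition \<mu> \<alpha> lam f \<and>
        (\<exists>g. inverse_extension f g \<and> arg_condition \<mu> \<alpha> lam g)}"

lemma inverse_extension_unique:
  assumes "inverse_extension f g" "inverse_extension f h" "z \<in> unit_disc"
  shows "g z = h z"
proof -
  have "\<forall>\<^sub>F w in nhds 0. g w = h w"
    using assms(1,2) unfolding inverse_extension_def by (auto elim: eventually_elim2)
  then obtain S where S: "open S" "0 \<in> S" "\<And>w. w \<in> S \<Longrightarrow> g w = h w"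
    unfolding eventually_nhds by blast
  show ?thesis
  proof (rule analytic_continuation_open[where f = g and g = h and s = "S \<inter> unit_disc" and s' = unit_disc])
    show "S \<inter> unit_disc \<noteq> {}" using S(2) by auto
    show "open (S \<inter> unit_disc)" using S(1) by auto
  qed (use S(3) assms(1,2) in \<open>simp_all add: inverse_extension_def\<close>, use assms(3) in simp)
qed

lemma log_branch_unique:
  assumes "is_log_branch h L" "is_log_branch h M" "z \<in> unit_disc"
  shows "L z = M z"
proof -
  have lm: "exp (L w) = exp (M w)" if "w \<in> unit_disc" for w
    using assms(1,2) that by (simp add: is_log_branch_def)
  have "(\<lambda>z. L z - M z) constant_on unit_disc"
  proof (rule continuous_discrete_range_constant)
    show "continuous_on unit_disc (\<lambda>z. L z - M z)"
      using assms unfolding is_log_branch_def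
      by (intro holomorphic_on_imp_continuous_on holomorphic_on_diff) simp_all
    show "\<exists>e>0. \<forall>y. y \<in> unit_disc \<and> L y - M y \<noteq> L x - M x \<longrightarrow> e \<le> norm (L y - M y - (L x - M x))"
      if x: "x \<in> unit_disc" for x
    proof (intro exI[of _ "2 * pi"] conjI allI impI)
      fix y assume y: "y \<in> unit_disc \<and> L y - M y \<noteq> L x - M x"
      define u where "u = L y - M y - (L x - M x)"
      have "exp (L y - M y) = 1" "exp (L x - M x) = 1"
        using lm[of x] lm[of y] x y by (simp_all add: exp_diff)
      then have "exp u = 1" by (simp add: u_def exp_diff)
      then obtain n :: int where n: "Re u = 0" "Im u = of_int (2 * n) * pi"
        by (auto simp: exp_eq_1)
      moreover have "n \<noteq> 0" using n y by (auto simp: u_def complex_eq_iff)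
      then have "1 \<le> \<bar>real_of_int n\<bar>" by linarith
      moreover have "norm u = 2 * pi * \<bar>real_of_int n\<bar>"
        using n by (simp add: cmod_eq_Im abs_mult)
      ultimately show "2 * pi \<le> norm (L y - M y - (L x - M x))"
        unfolding u_def[symmetric] by simp
    qed auto
  qed auto
  then obtain c where c: "\<And>w. w \<in> unit_disc \<Longrightarrow> L w - M w = c"
    unfolding constant_on_def by blast
  have "c = 0" using c[of 0] assms by (simp add: is_log_branch_def)
  then show ?thesis using c[OF assms(3)] by simp
qed

lemma log_branch_exists:
  assumes "f holomorphic_on unit_disc" "inj_on f unit_disc" "f 0 = 0" "deriv f 0 = 1"
  shows "is_log_branch (quot f) (log_branch (quot f))"
proof -
  have "quot f holomorphic_on unit_disc"
    by (rule pole_theorem_open_0[where g = f and a = 0]) (use assms in \<open>auto simp: quot_def\<close>)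
  moreover have "quot f z \<noteq> 0" if "z \<in> unit_disc" for z
    using inj_onD[OF assms(2), of z 0] that assms(3) by (auto simp: quot_def)
  ultimately obtain L where L: "L holomorphic_on unit_disc"
      "\<And>z. z \<in> unit_disc \<Longrightarrow> quot f z = exp (L z)"
    using contractible_imp_holomorphic_log[OF _ convex_imp_contractible[OF convex_ball]] by blast
  have "exp (L 0) = 1" using L(2)[of 0] by (simp add: quot_def)
  then have "is_log_branch (quot f) (\<lambda>z. L z - L 0)"
    unfolding is_log_branch_def using L by (auto simp: exp_diff intro!: holomorphic_intros)
  then show ?thesis unfolding log_branch_def by (rule someI[where P = "is_log_branch (quot f)"])
qed

end

theory Submission
  imports Defs
begin

text \<open>Writing the expression in the argument condition as \<open>p powr \<alpha>\<close>, the function \<open>p\<close> has positive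
  real part and \<open>p 0 = 1\<close>, so its first two coefficients have modulus at most \<open>2\<close>
  (Caratheodory). The same holds for the corresponding function \<open>q\<close> of the inverse,
  whose coefficients are \<open>- a 2\<close> and \<open>2 * (a 2)\<^sup>2 - a 3\<close>. Comparing second order coefficients and
  adding the two relations isolates \<open>(a 2)\<^sup>2\<close>; subtracting them gives \<open>a 3 - (a 2)\<^sup>2\<close>.\<close>

section \<open>Low-order coefficients of products and compositions, and expansions at the
  origin\<close>

lemma fps_nth_mult_le_2:
  fixes A B :: "'a :: comm_semiring_1 fps"
  shows "fps_nth (A * B) 1 = fps_nth A 0 * fps_nth B 1 + fps_nth A 1 * fps_nth B 0"
    and "fps_nth (A * B) 2 = fps_nth A 0 * fps_nth B 2 + fps_nth A 1 * fps_nth B 1 + fps_nth A 2 * fps_nth B 0"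
  by (simp_all add: fps_mult_nth numeral_2_eq_2 add.assoc)

lemma fps_nth_compose_le_3:
  fixes F G :: "'a :: comm_ring_1 fps"
  assumes "fps_nth G 0 = 0"
  shows "fps_nth (F oo G) 1 = fps_nth F 1 * fps_nth G 1"
    and "fps_nth (F oo G) 2 = fps_nth F 1 * fps_nth G 2 + fps_nth F 2 * (fps_nth G 1)\<^sup>2"
    and "fps_nth (F oo G) 3 =
      fps_nth F 1 * fps_nth G 3 + fps_nth F 2 * (2 * fps_nth G 1 * fps_nth G 2) + fps_nth F 3 * fps_nth G 1 ^ 3"
  using assms
  by (simp_all add: fps_compose_nth fps_mult_nth numeral_2_eq_2 numeral_3_eq_3 algebra_simps)

text \<open>Every power that occurs later is the exponential of \<open>c\<close> times a logarithm
  vanishing at the origin. This reduces its first two coefficients to those of the logarithm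
  \<open>U\<close>, with \<open>c\<close> as a parameter.\<close>

lemma fps_nth_exp_compose_le_2:
  fixes U :: "complex fps"
  assumes "fps_nth U 0 = 0"
  shows "fps_nth (fps_exp c oo U) 1 = c * fps_nth U 1"
    and "fps_nth (fps_exp c oo U) 2 = c * fps_nth U 2 + c\<^sup>2 / 2 * (fps_nth U 1)\<^sup>2"
  using fps_nth_compose_le_3[OF assms, of "fps_exp c"] by simp_all

lemma holomorphic_on_disc_has_fps_expansion:
  assumes "f holomorphic_on unit_disc"
  shows "f has_fps_expansion fps_expansion f 0"
  using assms by (intro has_fps_expansion_fps_expansion[of unit_disc]) auto

lemma has_fps_expansion_transform_eventually:
  assumes "f has_fps_expansion F" "\<forall>\<^sub>F z in nhds 0. f z = g z"
  shows "g has_fps_expansion F"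
  using has_fps_expansion_cong[OF assms(2) refl] assms(1) by blast

section \<open>Coefficient bounds for functions on the disc\<close>

text \<open>The function is only given on the open disc, so Cauchy's inequality is applied at radii
  \<open>r\<close> below \<open>1\<close>. The resulting factor \<open>r ^ n\<close> disappears as
  \<open>r\<close> tends to \<open>1\<close>.\<close>

lemma fps_nth_bounded_disc:
  assumes h: "h holomorphic_on unit_disc" and F: "h has_fps_expansion F"
    and b: "\<And>z. z \<in> unit_disc \<Longrightarrow> norm (h z) \<le> 1"
  shows "norm (fps_nth F n) \<le> 1"
proof -
  have "norm (fps_nth F n) * r ^ n \<le> 1" if r: "r \<in> {0<..<1}" for r :: real
  proof -
    have sub: "cball (0::complex) r \<subseteq> unit_disc" using r by auto
    have "norm ((deriv ^^ n) h 0) \<le> fact n * 1 / r ^ n"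
    proof (rule Cauchy_inequality)
      show "h holomorphic_on ball 0 r"
        using h sub ball_subset_cball by (blast intro: holomorphic_on_subset)
      show "continuous_on (cball 0 r) h"
        using h sub by (blast intro: holomorphic_on_subset holomorphic_on_imp_continuous_on)
    qed (use r b in auto)
    then show ?thesis
      using r by (simp add: fps_nth_fps_expansion[OF F] norm_divide field_simps)
  qed
  then have "\<forall>\<^sub>F r in at_left 1. norm (fps_nth F n) * r ^ n \<le> 1"
    using eventually_at_left_real[of 0 "1::real"] by (auto elim: eventually_mono)
  moreover have "((\<lambda>r. norm (fps_nth F n) * r ^ n) \<longlongrightarrow> norm (fps_nth F n) * 1 ^ n) (at_left 1)"
    by (intro tendsto_intros)
  ultimately show ?thesis
    by (intro tendsto_upperbound[where F = "at_left (1::real)"]) auto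
qed

text \<open>The Cayley transform carries the right half plane to the disc, where Cauchy's estimate
  applies.\<close>

lemma half_plane_first_coeff_bound:
  assumes p: "p holomorphic_on unit_disc" and P: "p has_fps_expansion P" and n: "0 < n"
    and P0: "fps_nth P 0 = 1" and P_low: "\<And>k. 0 < k \<Longrightarrow> k < n \<Longrightarrow> fps_nth P k = 0"
    and re: "\<And>z. z \<in> unit_disc \<Longrightarrow> 0 < Re (p z)"
  shows "norm (fps_nth P n) \<le> 2"
proof -
  define h where "h = (\<lambda>z. (p z - 1) / (p z + 1))"
  have nz: "p z + 1 \<noteq> 0" if "z \<in> unit_disc" for z
    using re[OF that] by (auto simp: complex_eq_iff)
  have hol: "h holomorphic_on unit_disc"
    unfolding h_def by (intro holomorphic_intros p) (use nz in auto)
  have bound: "norm (h z) \<le> 1" if "z \<in> unit_disc" for z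
  proof -
    \<comment> \<open>The right side minus the left side is \<open>4 * Re (p z)\<close>.\<close>
    have "(norm (p z - 1))\<^sup>2 \<le> (norm (p z + 1))\<^sup>2"
      using re[OF that] unfolding cmod_power2 by (simp add: power2_eq_square algebra_simps)
    then have "norm (p z - 1) \<le> norm (p z + 1)" by (rule power2_le_imp_le) simp
    then show ?thesis by (simp add: h_def norm_divide divide_le_eq_1 nz[OF that])
  qed
  define H where "H = fps_expansion h 0"
  have H: "h has_fps_expansion H"
    unfolding H_def by (rule holomorphic_on_disc_has_fps_expansion[OF hol])
  have "(\<lambda>z. h z * (p z + 1)) has_fps_expansion H * (P + 1)"
    by (intro fps_expansion_intros H P)
  moreover have "\<forall>\<^sub>F z in nhds 0. h z * (p z + 1) = p z - 1"
    using eventually_nhds_in_open[of unit_disc "0::complex"]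
    by (auto simp: h_def nz elim!: eventually_mono)
  ultimately have "(\<lambda>z. p z - 1) has_fps_expansion H * (P + 1)"
    by (rule has_fps_expansion_transform_eventually)
  moreover have "(\<lambda>z. p z - 1) has_fps_expansion P - 1"
    by (intro fps_expansion_intros P)
  ultimately have eq: "P - 1 = H * (P + 1)" by (rule fps_expansion_unique_complex[symmetric])
  have "fps_nth H 0 = 0" using arg_cong[OF eq, of "\<lambda>F. fps_nth F 0"] P0 by simp
  have "fps_nth P n = (\<Sum>i=0..n. fps_nth H i * fps_nth (P + 1) (n - i))"
    using arg_cong[OF eq, of "\<lambda>F. fps_nth F n"] n by (simp add: fps_mult_nth)
  \<comment> \<open>The term with \<open>i = 0\<close> vanishes because the Cayley transform is
    \<open>0\<close> at the origin, and those with \<open>0 < i < n\<close> vanish because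
    \<open>P\<close> has no coefficients in degrees \<open>1\<close> to \<open>n - 1\<close>. In the
    last term the factor \<open>2\<close> is the constant coefficient of
    \<open>P + 1\<close>.\<close>
  also have "\<dots> = (\<Sum>i=0..n. if i = n then 2 * fps_nth H i else 0)"
  proof (rule sum.cong[OF refl])
    fix i assume "i \<in> {0..n}"
    then show "fps_nth H i * fps_nth (P + 1) (n - i) = (if i = n then 2 * fps_nth H i else 0)"
      using P0 P_low[of "n - i"] \<open>fps_nth H 0 = 0\<close> by (cases "i = 0") auto
  qed
  also have "\<dots> = 2 * fps_nth H n" by simp
  finally show ?thesis
    using fps_nth_bounded_disc[OF hol H bound, of n] by (simp add: norm_mult)
qed

lemma caratheodory_coeff_le_2:
  assumes p: "p holomorphic_on unit_disc" and P: "p has_fps_expansion P"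
    and P0: "fps_nth P 0 = 1"
    and re: "\<And>z. z \<in> unit_disc \<Longrightarrow> 0 < Re (p z)"
  shows "norm (fps_nth P 1) \<le> 2" and "norm (fps_nth P 2) \<le> 2"
proof -
  show "norm (fps_nth P 1) \<le> 2"
    by (rule half_plane_first_coeff_bound[OF p P _ P0 _ re]) auto
  txt \<open>Taking the even part removes the linear coefficient, so that the second one becomes the
    first non-vanishing one.\<close>
  define q where "q = (\<lambda>z. 1 / 2 * (p z + (p \<circ> (\<lambda>z. - z)) z))"
  have neg: "(\<lambda>z::complex. - z) has_fps_expansion - fps_X"
    by (intro fps_expansion_intros)
  have Q: "q has_fps_expansion fps_const (1/2) * (P + (P oo - fps_X))"
    unfolding q_def by (intro fps_expansion_intros P neg) auto
  have qhol: "q holomorphic_on unit_disc"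
    unfolding q_def by (intro holomorphic_intros p holomorphic_on_compose_gen[OF _ p]) auto
  have c: "fps_nth (P oo - fps_X) 1 = - fps_nth P 1" "fps_nth (P oo - fps_X) 2 = fps_nth P 2"
    using fps_nth_compose_le_3(1,2)[of "- fps_X" P] by simp_all
  have "norm (fps_nth (fps_const (1/2) * (P + (P oo - fps_X))) 2) \<le> 2"
  proof (rule half_plane_first_coeff_bound[OF qhol Q])
    fix k :: nat assume "0 < k" "k < 2"
    then have "k = 1" by simp
    then show "fps_nth (fps_const (1/2) * (P + (P oo - fps_X))) k = 0"
      using c by simp
  next
    fix z :: complex assume "z \<in> unit_disc"
    then show "0 < Re (q z)" using re[of z] re[of "- z"] by (simp add: q_def)
  qed (use P0 in simp_all)
  then show "norm (fps_nth P 2) \<le> 2" using c by simp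
qed

section \<open>From the argument condition to relations between coefficients\<close>

text \<open>Dividing the principal logarithm of \<open>h\<close> by \<open>\<alpha>\<close> widens
  the sector to the right half plane: \<open>exp u\<close> has positive real part because the
  imaginary part of \<open>u\<close> stays below \<open>pi / 2\<close> in modulus. The numbers
  \<open>p1\<close> and \<open>p2\<close> are the coefficients of \<open>exp u\<close>, while
  \<open>h\<close> itself is \<open>exp (\<alpha> * u)\<close>.\<close>

lemma sector_coeff_relations:
  assumes \<alpha>: "0 < \<alpha>" "\<alpha> \<le> 1"
    and h: "h holomorphic_on unit_disc" and H: "h has_fps_expansion H" and H0: "fps_nth H 0 = 1"
    and arg: "\<And>z. z \<in> unit_disc \<Longrightarrow> h z \<noteq> 0 \<and> \<bar>Arg (h z)\<bar> < \<alpha> * pi / 2"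
  obtains p1 p2 where "norm p1 \<le> 2" "norm p2 \<le> 2"
    "fps_nth H 1 = of_real \<alpha> * p1"
    "fps_nth H 2 = of_real \<alpha> * p2 + of_real \<alpha> * (of_real \<alpha> - 1) / 2 * p1\<^sup>2"
proof -
  define u where "u = (\<lambda>z. Ln (h z) / of_real \<alpha>)"
  have slit: "h z \<notin> \<real>\<^sub>\<le>\<^sub>0" if "z \<in> unit_disc" for z
  proof
    assume "h z \<in> \<real>\<^sub>\<le>\<^sub>0"
    then have "Arg (h z) = pi"
      using arg[OF that] by (auto simp: Arg_eq_pi complex_nonpos_Reals_iff complex_eq_iff)
    moreover have "\<alpha> * pi \<le> pi" using \<alpha> by simp
    ultimately show False using arg[OF that] pi_gt_zero by linarith
  qed
  have uhol: "u holomorphic_on unit_disc"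
    unfolding u_def by (intro holomorphic_intros h) (use slit \<alpha> in auto)
  define U where "U = fps_expansion u 0"
  have U: "u has_fps_expansion U"
    unfolding U_def by (rule holomorphic_on_disc_has_fps_expansion[OF uhol])
  have "h 0 = 1" using fps_nth_fps_expansion[OF H, of 0] H0 by simp
  then have U0: "fps_nth U 0 = 0"
    using fps_nth_fps_expansion[OF U, of 0] by (simp add: u_def)
  define p where "p = (\<lambda>z. exp (1 * z)) \<circ> u"
  have P: "p has_fps_expansion (fps_exp 1 oo U)"
    unfolding p_def by (intro fps_expansion_intros U U0)
  have phol: "p holomorphic_on unit_disc"
    unfolding p_def o_def by (intro holomorphic_intros uhol)
  have re: "0 < Re (p z)" if "z \<in> unit_disc" for z
  proof -
    have "\<bar>Im (u z)\<bar> < pi / 2"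
      using arg[OF that] \<alpha> by (auto simp: u_def Arg_eq_Im_Ln field_simps)
    then have "0 < cos (Im (u z))" by (intro cos_gt_zero_pi) (auto simp: abs_less_iff)
    then show ?thesis by (simp add: p_def Re_exp)
  qed
  have "((\<lambda>z. exp (of_real \<alpha> * z)) \<circ> u) has_fps_expansion (fps_exp (of_real \<alpha>) oo U)"
    by (intro fps_expansion_intros U U0)
  moreover have "\<forall>\<^sub>F z in nhds 0. ((\<lambda>z. exp (of_real \<alpha> * z)) \<circ> u) z = h z"
    using eventually_nhds_in_open[of unit_disc "0::complex"] \<alpha> arg
    by (auto simp: u_def elim!: eventually_mono)
  ultimately have "h has_fps_expansion (fps_exp (of_real \<alpha>) oo U)"
    by (rule has_fps_expansion_transform_eventually)
  then have "H = fps_exp (of_real \<alpha>) oo U" by (rule fps_expansion_unique_complex[OF H])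
  \<comment> \<open>Both series are exponentials of multiples of \<open>U\<close>. In degree two the
    square of the linear coefficient of \<open>U\<close> enters with weight
    \<open>\<alpha>\<^sup>2 / 2\<close> in \<open>H\<close> but \<open>1 / 2\<close> in
    \<open>exp u\<close>; the term with \<open>\<alpha> * (\<alpha> - 1) / 2\<close> corrects
    this.\<close>
  then have "fps_nth H 1 = of_real \<alpha> * fps_nth (fps_exp 1 oo U) 1"
    "fps_nth H 2 = of_real \<alpha> * fps_nth (fps_exp 1 oo U) 2
       + of_real \<alpha> * (of_real \<alpha> - 1) / 2 * (fps_nth (fps_exp 1 oo U) 1)\<^sup>2"
    unfolding fps_nth_exp_compose_le_2[OF U0] \<open>H = _\<close>
    by (simp_all add: field_simps power2_eq_square)
  moreover have "norm (fps_nth (fps_exp 1 oo U) 1) \<le> 2" "norm (fps_nth (fps_exp 1 oo U) 2) \<le> 2"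
    by (rule caratheodory_coeff_le_2[OF phol P _ re]; simp)+
  ultimately show thesis using that by blast
qed

text \<open>One logarithm of \<open>quot f\<close> serves all exponents: its series \<open>L\<close>
  yields the power \<open>s\<close> as the exponential of \<open>s * L\<close>. The case
  \<open>s = 1\<close>, multiplied by \<open>z\<close>, gives back \<open>f\<close>, which links
  \<open>L\<close> to the coefficients of \<open>f\<close>.\<close>

lemma branch_power_quot_expansion:
  assumes f: "f holomorphic_on unit_disc" "inj_on f unit_disc"
    and F: "f has_fps_expansion F" "fps_nth F 0 = 0" "fps_nth F 1 = 1"
  obtains L where "fps_nth L 0 = 0" "fps_nth F 2 = fps_nth L 1"
    "fps_nth F 3 = fps_nth L 2 + (fps_nth L 1)\<^sup>2 / 2"
    "\<And>s. branch_power (quot f) s holomorphic_on unit_disc"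
    "\<And>s. branch_power (quot f) s has_fps_expansion (fps_exp (of_real s) oo L)"
proof -
  have "f 0 = 0" "deriv f 0 = 1"
    using fps_nth_fps_expansion[OF F(1), of 0] fps_nth_fps_expansion[OF F(1), of 1] F(2,3) by auto
  then have lb: "is_log_branch (quot f) (log_branch (quot f))"
    by (intro log_branch_exists f)
  define l where "l = log_branch (quot f)"
  have l: "l holomorphic_on unit_disc" "l 0 = 0" "\<And>z. z \<in> unit_disc \<Longrightarrow> exp (l z) = quot f z"
    using lb by (auto simp: is_log_branch_def l_def)
  define L where "L = fps_expansion l 0"
  have L: "l has_fps_expansion L"
    unfolding L_def by (rule holomorphic_on_disc_has_fps_expansion[OF l(1)])
  have L0: "fps_nth L 0 = 0" using fps_nth_fps_expansion[OF L, of 0] l(2) by simp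
  have ex: "((\<lambda>z. exp (c * z)) \<circ> l) has_fps_expansion (fps_exp c oo L)" for c
    by (intro fps_expansion_intros L L0)
  have bp: "branch_power (quot f) s = (\<lambda>z. exp (of_real s * z)) \<circ> l" for s
    by (simp add: branch_power_def l_def fun_eq_iff)
  have "(\<lambda>z. z * ((\<lambda>z. exp (1 * z)) \<circ> l) z) has_fps_expansion fps_X * (fps_exp 1 oo L)"
    by (intro fps_expansion_intros ex)
  moreover have "\<forall>\<^sub>F z in nhds 0. z * ((\<lambda>z. exp (1 * z)) \<circ> l) z = f z"
    using eventually_nhds_in_open[of unit_disc "0::complex"] \<open>f 0 = 0\<close>
    by (auto simp: l(3) quot_def elim!: eventually_mono)
  ultimately have "f has_fps_expansion fps_X * (fps_exp 1 oo L)"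
    by (rule has_fps_expansion_transform_eventually)
  then have Feq: "F = fps_X * (fps_exp 1 oo L)" by (rule fps_expansion_unique_complex[OF F(1)])
  show thesis
  proof (rule that[OF L0])
    show "fps_nth F 2 = fps_nth L 1" "fps_nth F 3 = fps_nth L 2 + (fps_nth L 1)\<^sup>2 / 2"
      using fps_nth_exp_compose_le_2[OF L0, of 1] by (simp_all add: Feq)
    show "branch_power (quot f) s holomorphic_on unit_disc" for s
      unfolding bp o_def by (intro holomorphic_intros l)
    show "branch_power (quot f) s has_fps_expansion (fps_exp (of_real s) oo L)" for s
      unfolding bp by (rule ex)
  qed
qed

text \<open>If \<open>l\<close> is the logarithm of \<open>quot f\<close>, then f' = exp(l) (1 + z
  l'), so the expression is exp(\<mu> l) (1 + lam z l'). Its degree-two coefficient in terms of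
  \<open>L\<close> factors as \<open>2 * lam + \<mu>\<close> times
  \<open>L_2 + \<mu> / 2 * L_1^2\<close>. Replacing \<open>L_2\<close> by the coefficients of
  \<open>f\<close> turns \<open>\<mu>\<close> into \<open>\<mu> - 1\<close>. The lemma serves both
  \<open>f\<close> and its inverse.\<close>

lemma arg_condition_coeff_relations:
  assumes \<alpha>: "0 < \<alpha>" "\<alpha> \<le> 1"
    and f: "f holomorphic_on unit_disc" "inj_on f unit_disc"
    and F: "f has_fps_expansion F" "fps_nth F 0 = 0" "fps_nth F 1 = 1"
    and arg: "arg_condition \<mu> \<alpha> lam f"
  obtains p1 p2 where "norm p1 \<le> 2" "norm p2 \<le> 2"
    "of_real (lam + \<mu>) * fps_nth F 2 = of_real \<alpha> * p1"
    "of_real (2 * lam + \<mu>) * (fps_nth F 3 + of_real (\<mu> - 1) / 2 * (fps_nth F 2)\<^sup>2)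
       = of_real \<alpha> * p2 + of_real \<alpha> * (of_real \<alpha> - 1) / 2 * p1\<^sup>2"
proof -
  obtain L where L: "fps_nth L 0 = 0" "fps_nth F 2 = fps_nth L 1"
    "fps_nth F 3 = fps_nth L 2 + (fps_nth L 1)\<^sup>2 / 2"
    and bhol: "\<And>s. branch_power (quot f) s holomorphic_on unit_disc"
    and bexp: "\<And>s. branch_power (quot f) s has_fps_expansion (fps_exp (of_real s) oo L)"
    using branch_power_quot_expansion[OF f F] by blast
  define H where "H = fps_const (1 - of_real lam) * (fps_exp (of_real \<mu>) oo L)
     + fps_const (of_real lam) * fps_deriv F * (fps_exp (of_real (\<mu> - 1)) oo L)"
  have H: "N_expr \<mu> lam f has_fps_expansion H"
    unfolding H_def N_expr_def by (intro fps_expansion_intros bexp F)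
  have hol: "N_expr \<mu> lam f holomorphic_on unit_disc"
    unfolding N_expr_def by (intro holomorphic_intros bhol f) auto
  have H0: "fps_nth H 0 = 1" using F(3) by (simp add: H_def)
  obtain p1 p2 where p: "norm p1 \<le> 2" "norm p2 \<le> 2" "fps_nth H 1 = of_real \<alpha> * p1"
    "fps_nth H 2 = of_real \<alpha> * p2 + of_real \<alpha> * (of_real \<alpha> - 1) / 2 * p1\<^sup>2"
    using sector_coeff_relations[OF \<alpha> hol H H0] arg unfolding arg_condition_def by metis
  have d: "fps_nth (fps_deriv F) 0 = 1" "fps_nth (fps_deriv F) 1 = 2 * fps_nth F 2"
    "fps_nth (fps_deriv F) 2 = 3 * fps_nth F 3"
    using F(3) by (simp_all add: numeral_2_eq_2 numeral_3_eq_3)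
  have "fps_nth H 1 = of_real (lam + \<mu>) * fps_nth F 2"
    unfolding H_def fps_add_nth mult.assoc fps_mult_left_const_nth fps_nth_mult_le_2
      fps_nth_exp_compose_le_2[OF L(1)] d L
    by (simp add: algebra_simps)
  moreover have "fps_nth H 2 =
      of_real (2 * lam + \<mu>) * (fps_nth F 3 + of_real (\<mu> - 1) / 2 * (fps_nth F 2)\<^sup>2)"
    unfolding H_def fps_add_nth mult.assoc fps_mult_left_const_nth fps_nth_mult_le_2
      fps_nth_exp_compose_le_2[OF L(1)] d L
    by (simp add: field_simps power2_eq_square)
  ultimately show thesis using that p by simp
qed

section \<open>Coefficients of the inverse and of the given Taylor series\<close>

text \<open>Near the origin \<open>f \<circ> g\<close> is the identity, so
  \<open>F oo G = fps_X\<close>. Since \<open>F\<close> has linear coefficient \<open>1\<close>,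
  this equation can be solved for \<open>G\<close> degree by degree.\<close>

lemma inverse_extension_expansion:
  assumes f: "f holomorphic_on unit_disc" "inj_on f unit_disc"
    and F: "f has_fps_expansion F" "fps_nth F 0 = 0" "fps_nth F 1 = 1"
    and g: "inverse_extension f g"
  obtains G where "g has_fps_expansion G" "fps_nth G 0 = 0" "fps_nth G 1 = 1"
    "fps_nth G 2 = - fps_nth F 2" "fps_nth G 3 = 2 * (fps_nth F 2)\<^sup>2 - fps_nth F 3"
proof -
  have ghol: "g holomorphic_on unit_disc"
    and gev: "\<forall>\<^sub>F w in nhds 0. g w = the_inv_into unit_disc f w"
    using g by (auto simp: inverse_extension_def)
  have "f 0 = 0" using fps_nth_fps_expansion[OF F(1), of 0] F(2) by simp
  then have "the_inv_into unit_disc f 0 = 0"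
    using the_inv_into_f_f[OF f(2), of 0] by simp
  then have "g 0 = 0" using eventually_nhds_x_imp_x[OF gev] by simp
  define G where "G = fps_expansion g 0"
  have G: "g has_fps_expansion G"
    unfolding G_def by (rule holomorphic_on_disc_has_fps_expansion[OF ghol])
  have G0: "fps_nth G 0 = 0" using fps_nth_fps_expansion[OF G, of 0] \<open>g 0 = 0\<close> by simp
  \<comment> \<open>\<open>the_inv_into\<close> is meaningful only on the image of \<open>f\<close>.
    The open mapping theorem makes that image a neighbourhood of \<open>0\<close>, so there
    \<open>g\<close> really is a right inverse.\<close>
  have "open (f ` unit_disc)"
    using f by (intro open_mapping_thm3) auto
  moreover have "0 \<in> f ` unit_disc" using \<open>f 0 = 0\<close> by force
  ultimately have "\<forall>\<^sub>F w in nhds 0. w \<in> f ` unit_disc" by (rule eventually_nhds_in_open)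
  then have ev: "\<forall>\<^sub>F w in nhds 0. (f \<circ> g) w = w"
    using gev by eventually_elim (simp add: f_the_inv_into_f[OF f(2)])
  have "(f \<circ> g) has_fps_expansion (F oo G)"
    by (intro fps_expansion_intros F G G0)
  then have "(\<lambda>w. w) has_fps_expansion (F oo G)"
    using ev by (rule has_fps_expansion_transform_eventually)
  then have FG: "F oo G = fps_X"
    by (rule fps_expansion_unique_complex[OF _ has_fps_expansion_fps_X])
  note nth = fps_nth_compose_le_3[OF G0, of F, unfolded FG F(3)]
  have G1: "fps_nth G 1 = 1" using nth(1) by simp
  have G2: "fps_nth G 2 = - fps_nth F 2"
    using nth(2) unfolding G1 by (simp add: eq_neg_iff_add_eq_0)
  have G3: "fps_nth G 3 = 2 * (fps_nth F 2)\<^sup>2 - fps_nth F 3"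
    using nth(3) unfolding G1 G2 by (simp add: algebra_simps power2_eq_square)
  show thesis by (rule that[OF G G0 G1 G2 G3])
qed

lemma taylor_form_expansion:
  assumes "taylor_form f a"
  obtains F where "f has_fps_expansion F" "fps_nth F 0 = 0" "fps_nth F 1 = 1"
    "fps_nth F 2 = a 2" "fps_nth F 3 = a 3"
proof -
  \<comment> \<open>\<open>taylor_form\<close> leaves \<open>a 0\<close> and \<open>a 1\<close>
    unspecified, so the first two coefficients are set by hand. They account for the term
    \<open>z\<close> subtracted in that definition.\<close>
  define F where "F = Abs_fps (\<lambda>n. if n = 0 then 0 else if n = 1 then 1 else a n)"
  have "(\<lambda>n. fps_nth F n * z ^ n) sums f z" if "z \<in> unit_disc" for z
  proof -
    have "(\<lambda>n. fps_nth F (n + 2) * z ^ (n + 2)) sums (f z - z)"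
      using assms that by (simp add: taylor_form_def F_def)
    then show ?thesis
      by (subst (asm) sums_iff_shift) (simp add: F_def numeral_2_eq_2)
  qed
  then have "\<forall>\<^sub>F z in nhds 0. (\<lambda>n. fps_nth F n * z ^ n) sums f z"
    using eventually_nhds_in_open[of unit_disc "0::complex"] by (auto elim!: eventually_mono)
  then have "f has_fps_expansion F" by (rule has_fps_expansionI)
  then show thesis by (rule that) (simp_all add: F_def)
qed

section \<open>Combination of the relations into the two estimates\<close>

theorem theorem2p1:
  fixes f :: "complex \<Rightarrow> complex" and a :: "nat \<Rightarrow> complex" and \<alpha> lam \<mu> :: real
  assumes "0 < \<alpha>" and "\<alpha> \<le> 1" and "lam \<ge> 1" and "\<mu> \<ge> 0"
    and "taylor_form f a"
    and "f \<in> class_N \<mu> \<alpha> lam"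
  shows "cmod (a 2) \<le> 2 * \<alpha> / sqrt ((lam + \<mu>)\<^sup>2 + \<alpha> * (\<mu> + 2 * lam - lam\<^sup>2))
       \<and> cmod (a 3) \<le> 4 * \<alpha>\<^sup>2 / (lam + \<mu>)\<^sup>2 + 2 * \<alpha> / (2 * lam + \<mu>)"
proof -
  obtain g where f: "f holomorphic_on unit_disc" "inj_on f unit_disc"
    and inv: "inverse_extension f g"
    and arg: "arg_condition \<mu> \<alpha> lam f" "arg_condition \<mu> \<alpha> lam g"
    using assms(6) by (auto simp: class_N_def bi_univalent_def class_A_def)
  have g: "g holomorphic_on unit_disc" "inj_on g unit_disc"
    using inv by (auto simp: inverse_extension_def)
  obtain F where F: "f has_fps_expansion F" "fps_nth F 0 = 0" "fps_nth F 1 = 1"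
    and F23: "fps_nth F 2 = a 2" "fps_nth F 3 = a 3"
    using taylor_form_expansion[OF assms(5)] by blast
  obtain G where G: "g has_fps_expansion G" "fps_nth G 0 = 0" "fps_nth G 1 = 1"
    and G23: "fps_nth G 2 = - a 2" "fps_nth G 3 = 2 * (a 2)\<^sup>2 - a 3"
    using inverse_extension_expansion[OF f F inv] unfolding F23 by blast
  obtain p1 p2 where p: "norm p1 \<le> 2" "norm p2 \<le> 2"
    "of_real (lam + \<mu>) * a 2 = of_real \<alpha> * p1"
    "of_real (2 * lam + \<mu>) * (a 3 + of_real (\<mu> - 1) / 2 * (a 2)\<^sup>2)
       = of_real \<alpha> * p2 + of_real \<alpha> * (of_real \<alpha> - 1) / 2 * p1\<^sup>2"
    using arg_condition_coeff_relations[OF assms(1,2) f F arg(1)] unfolding F23 by blast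
  obtain q1 q2 where q: "norm q1 \<le> 2" "norm q2 \<le> 2"
    "of_real (lam + \<mu>) * - a 2 = of_real \<alpha> * q1"
    "of_real (2 * lam + \<mu>) * (2 * (a 2)\<^sup>2 - a 3 + of_real (\<mu> - 1) / 2 * (- a 2)\<^sup>2)
       = of_real \<alpha> * q2 + of_real \<alpha> * (of_real \<alpha> - 1) / 2 * q1\<^sup>2"
    using arg_condition_coeff_relations[OF assms(1,2) g G arg(2)] unfolding G23 by blast
  define D where "D = (lam + \<mu>)\<^sup>2 + \<alpha> * (\<mu> + 2 * lam - lam\<^sup>2)"
  have pos: "0 < lam + \<mu>" "0 < 2 * lam + \<mu>" using assms by auto
  \<comment> \<open>The linear coefficients being opposite, both second-order relations contain the
    same square \<open>p1\<^sup>2\<close>; it survives in their sum and cancels in their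
    difference.\<close>
  have "of_real \<alpha> * q1 = of_real \<alpha> * - p1" using p(3) q(3) by (metis mult_minus_right)
  then have q1: "q1 = - p1" unfolding mult_cancel_left using assms(1) by simp
  \<comment> \<open>Expanding the square absorbs the negative term into
    \<open>(1 - \<alpha>) * lam\<^sup>2\<close>, nonnegative as \<open>\<alpha> \<le> 1\<close>.
    Strict positivity comes from \<open>2 * \<alpha> * lam\<close>.\<close>
  have "D = (1 - \<alpha>) * lam\<^sup>2 + \<mu>\<^sup>2 + 2 * lam * \<mu> + \<alpha> * \<mu> + 2 * \<alpha> * lam"
    by (simp add: D_def algebra_simps power2_eq_square)
  also have "\<dots> > 0" using assms(1-4) by (intro add_nonneg_pos add_nonneg_nonneg) auto
  finally have D: "0 < D" .
  have np: "norm (p2 + q2) \<le> 4" "norm (p2 - q2) \<le> 4"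
    using norm_triangle_ineq[of p2 q2] norm_triangle_ineq4[of p2 q2] p(2) q(2) by linarith+
  have "of_real (2 * lam + \<mu>) * of_real (\<mu> + 1) * (a 2)\<^sup>2
      = of_real (2 * lam + \<mu>) * (a 3 + of_real (\<mu> - 1) / 2 * (a 2)\<^sup>2)
        + of_real (2 * lam + \<mu>) * (2 * (a 2)\<^sup>2 - a 3 + of_real (\<mu> - 1) / 2 * (- a 2)\<^sup>2)"
    by (simp add: field_simps power2_eq_square)
  also have "\<dots> = of_real \<alpha> * (p2 + q2) + of_real \<alpha> * (of_real \<alpha> - 1) * p1\<^sup>2"
    unfolding p(4) q(4) q1 by (simp add: field_simps power2_eq_square)
  \<comment> \<open>The extra factor \<open>\<alpha>\<close> turns \<open>p1\<^sup>2\<close> into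
    \<open>(\<alpha> * p1)\<^sup>2\<close>, which the linear relation expresses by
    \<open>a 2\<close>. Moving that term to the left gives the coefficient \<open>\<alpha> * (2 *
    lam + \<mu>) * (\<mu> + 1) - (\<alpha> - 1) * (lam + \<mu>)\<^sup>2\<close>, which is
    \<open>D\<close>.\<close>
  finally have "of_real \<alpha> * (of_real (2 * lam + \<mu>) * of_real (\<mu> + 1) * (a 2)\<^sup>2)
      = of_real \<alpha> * (of_real \<alpha> * (p2 + q2) + of_real \<alpha> * (of_real \<alpha> - 1) * p1\<^sup>2)"
    by simp
  also have "\<dots> = (of_real \<alpha>)\<^sup>2 * (p2 + q2) + (of_real \<alpha> - 1) * (of_real (lam + \<mu>) * a 2)\<^sup>2"
    unfolding p(3) by (simp add: algebra_simps power2_eq_square)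
  finally have "of_real D * (a 2)\<^sup>2 = (of_real \<alpha>)\<^sup>2 * (p2 + q2)"
    by (simp add: D_def algebra_simps power2_eq_square)
  from arg_cong[OF this, of norm] have "D * (norm (a 2))\<^sup>2 = \<alpha>\<^sup>2 * norm (p2 + q2)"
    using D by (simp add: norm_mult norm_power)
  also have "\<dots> \<le> \<alpha>\<^sup>2 * 4" by (intro mult_left_mono np) auto
  finally have "(norm (a 2))\<^sup>2 \<le> (2 * \<alpha> / sqrt D)\<^sup>2"
    using D by (simp add: power_divide power_mult_distrib field_simps)
  then have a2: "norm (a 2) \<le> 2 * \<alpha> / sqrt D"
    by (rule power2_le_imp_le) (use assms D in auto)

  \<comment> \<open>In the difference the terms with \<open>\<mu> - 1\<close> cancel, since
    \<open>a 2\<close> and \<open>- a 2\<close> have the same square.\<close>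
  have "2 * of_real (2 * lam + \<mu>) * (a 3 - (a 2)\<^sup>2)
      = of_real (2 * lam + \<mu>) * (a 3 + of_real (\<mu> - 1) / 2 * (a 2)\<^sup>2)
        - of_real (2 * lam + \<mu>) * (2 * (a 2)\<^sup>2 - a 3 + of_real (\<mu> - 1) / 2 * (- a 2)\<^sup>2)"
    by (simp add: field_simps power2_eq_square)
  also have "\<dots> = of_real \<alpha> * (p2 - q2)"
    unfolding p(4) q(4) q1 by (simp add: field_simps power2_eq_square)
  finally have "2 * of_real (2 * lam + \<mu>) * (a 3 - (a 2)\<^sup>2) = of_real \<alpha> * (p2 - q2)" .
  from arg_cong[OF this, of norm] have "2 * (2 * lam + \<mu>) * norm (a 3 - (a 2)\<^sup>2) = \<alpha> * norm (p2 - q2)"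
    using pos assms(1) by (simp add: norm_mult del: of_real_add of_real_mult)
  also have "\<dots> \<le> \<alpha> * 4" using assms(1) by (intro mult_left_mono np) auto
  finally have diff: "norm (a 3 - (a 2)\<^sup>2) \<le> 2 * \<alpha> / (2 * lam + \<mu>)"
    using pos by (simp add: field_simps)
  \<comment> \<open>For \<open>a 3\<close>, the modulus of \<open>a 2\<close> is bounded through the
    linear relation instead of the estimate with \<open>D\<close>; this produces the denominator
    \<open>(lam + \<mu>)\<^sup>2\<close>.\<close>
  from arg_cong[OF p(3), of norm] have "(lam + \<mu>) * norm (a 2) = \<alpha> * norm p1"
    using pos assms(1) by (simp add: norm_mult del: of_real_add)
  also have "\<dots> \<le> \<alpha> * 2" using assms(1) by (intro mult_left_mono p) auto
  finally have "norm (a 2) \<le> 2 * \<alpha> / (lam + \<mu>)" using pos by (simp add: field_simps)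
  then have "(norm (a 2))\<^sup>2 \<le> (2 * \<alpha> / (lam + \<mu>))\<^sup>2" by (intro power_mono) auto
  then have "norm ((a 2)\<^sup>2) \<le> 4 * \<alpha>\<^sup>2 / (lam + \<mu>)\<^sup>2"
    by (simp add: norm_power power_divide power_mult_distrib)
  then have "norm (a 3) \<le> 4 * \<alpha>\<^sup>2 / (lam + \<mu>)\<^sup>2 + 2 * \<alpha> / (2 * lam + \<mu>)"
    using diff norm_triangle_sub[of "a 3" "(a 2)\<^sup>2"] by linarith
  with a2 show ?thesis by (simp add: D_def)
qed

end
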